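(* A map $d:\Phi\to\mathbb{K}\setminus\{0\}$, $\phi\mapsto\phi'$, extends to a series derivation on $\Gamma$ if the set $$E_1=\{\phi\in\Phi\ :\ \exists\,\psi\in\Phi,\ \psi\succ\phi,\ I_{\psi,\phi}\text{ is not a left shift}\}$$ is well-ordered in $\Phi$.
   Context: Let $(\Phi,\preccurlyeq)$ be a totally ordered set (the fundamental monomials). A set is anti-well-ordered if each nonempty subset has a greatest element. The Hahn group $\mathbf{H}(\Phi)$ is the set of formal products $\gamma=\prod_{\phi\in\Phi}\phi^{\gamma_\phi}$ with $\gamma_\phi\in\mathbb{R}$ and $\mathrm{supp}\,\gamma:=\{\phi\in\Phi:\gamma_\phi\neq 0\}$ anti-well-ordered in $\Phi$; multiplication adds exponents pointwise, and $\gamma\succ 1$ iff $\gamma_\phi>0$ for $\phi=\max(\mathrm{supp}\,\gamma)$. This is a totally ordered abelian group, with $\Phi\subset\mathbf{H}(\Phi)$ as ordered set. Fix a subgroup $\Gamma$ of $\mathbf{H}(\Phi)$ with $\Phi\subset\Gamma$. $\mathbb{K}:=\mathbb{R}((\Gamma))$ is the field of generalised series $a=\sum_{\alpha}a_\alpha\alpha$, i.e. maps $a:\Gamma\to\mathbb{R}$ whose support $\mathrm{Supp}\,a=\{\alpha\in\Gamma: a_\alpha\ne0\}$ is anti-well-ordered in $\Gamma$, with componentwise sum and convolution product. A family $(a_i)_{i\in I}$ in $\mathbb{K}$ is summable if $\bigcup_i\mathrm{Supp}\,a_i$ is anti-well-ordered in $\Gamma$ and for each $\alpha$ the set $\{i\in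 I:\alpha\in\mathrm{Supp}\,a_i\}$ is finite; its sum is then defined coefficientwise (finite families are always summable). A map $d:\Phi\to\mathbb{K}\setminus\{0\}$, $\phi\mapsto\phi'$, extends to a series derivation on $\Gamma$ if for every $\alpha\in\Gamma$ the family $\left(\frac{\phi'}{\phi}\right)_{\phi\in\mathrm{supp}\,\alpha}$ is summable. The series derivation on $\Gamma$ is then the map $\Gamma\to\mathbb{K}$ given by $1'=0$ and $\alpha'=\alpha\sum_{\phi\in\mathrm{supp}\,\alpha}\alpha_\phi\frac{\phi'}{\phi}$. The isomorphisms $I_{\mu,\nu}$: the order type $ot(E)$ of an anti-well-ordered set $E$ is identified with the ordinal enumerating $E$ in decreasing order. If $\mu,\nu\in\Phi$ and $ot(\mathrm{Supp}\,\frac{\mu'}{\mu})\le ot(\mathrm{Supp}\,\frac{\nu'}{\nu})$, then $I_{\mu,\nu}$ denotes the isomorphism of ordered sets from $\mathrm{Supp}\,\frac{\mu'}{\mu}$ onto a final (upper) segment of $\mathrm{Supp}\,\frac{\nu'}{\nu}$, and $I_{\nu,\mu}$ denotes its inverse (defined on that final segment). Thus, for all $\mu,\nu$, $I_{\mu,\nu}$ sends the element at position $\lambda$ (an ordinal) in the decreasing enumeration of $\mathrm{Supp}\,\frac{\mu'}{\mu}$ to the element at position $\lambda$ of $\mathrm{Supp}\,\frac{\nu'}{\nu}$, whenever both exist. $I_{\mu,\nu}$ is a left shift if $I_{\mu,\nu}(\gamma)\prec\gamma$ for every $\gamma$ in the domain of $I_{\mu,\nu}$. *)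

theory Defs
  imports Complex_Main
begin

definition well_ordered_set :: "'a::linorder set \<Rightarrow> bool" where
  "well_ordered_set A \<longleftrightarrow> (\<forall>X\<subseteq>A. X \<noteq> {} \<longrightarrow> (\<exists>m\<in>X. \<forall>x\<in>X. m \<le> x))"

definition anti_well_ordered :: "'a::linorder set \<Rightarrow> bool" where
  "anti_well_ordered A \<longleftrightarrow> (\<forall>X\<subseteq>A. X \<noteq> {} \<longrightarrow> (\<exists>m\<in>X. \<forall>x\<in>X. x \<le> m))"

definition supp :: "('a \<Rightarrow> real) \<Rightarrow> 'a set" where
  "supp f = {x. f x \<noteq> 0}"

lemma anti_well_ordered_subset:
  "anti_well_ordered B \<Longrightarrow> A \<subseteq> B \<Longrightarrow> anti_well_ordered A"
  unfolding anti_well_ordered_def by (meson subset_trans)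

lemma anti_well_ordered_empty [simp]: "anti_well_ordered {}"
  unfolding anti_well_ordered_def by simp

lemma anti_well_ordered_singleton [simp]: "anti_well_ordered {x}"
  unfolding anti_well_ordered_def by (auto simp: subset_singleton_iff)

lemma anti_well_ordered_Un:
  assumes "anti_well_ordered A" "anti_well_ordered B"
  shows "anti_well_ordered (A \<union> B)"
  unfolding anti_well_ordered_def
proof (intro allI impI)
  fix X assume X: "X \<subseteq> A \<union> B" "X \<noteq> {}"
  have greatest: "\<exists>m\<in>Y. \<forall>x\<in>Y. x \<le> m"
    if "Y \<noteq> {}" "Y \<subseteq> A \<or> Y \<subseteq> B" for Y
    using assms[unfolded anti_well_ordered_def, rule_format, of Y] that by metis
  show "\<exists>m\<in>X. \<forall>x\<in>X. x \<le> m"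
  proof (cases "X \<inter> A = {} \<or> X \<inter> B = {}")
    case True
    then have "X \<subseteq> A \<or> X \<subseteq> B" using X by blast
    then show ?thesis using greatest[of X] X by simp
  next
    case False
    obtain m where m: "m \<in> X \<inter> A" "\<forall>x\<in>X \<inter> A. x \<le> m"
      using greatest[of "X \<inter> A"] False by auto
    obtain n where n: "n \<in> X \<inter> B" "\<forall>x\<in>X \<inter> B. x \<le> n"
      using greatest[of "X \<inter> B"] False by auto
    have "max m n \<in> X" using m n by (simp add: max_def)
    moreover have "\<forall>x\<in>X. x \<le> max m n" using m n X by (auto simp: le_max_iff_disj)
    ultimately show ?thesis by blast
  qed
qed

text \<open>The Hahn group over the totally ordered set given by the type of the exponent indices.
  An element is its exponent function, and the group is written additively: the product of formal
  products is \<open>+\<close>, the trivial product is \<open>0\<close>, inversion is unary minus.\<close>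

typedef (overloaded) 'a hahn = "{f :: 'a::linorder \<Rightarrow> real. anti_well_ordered (supp f)}"
  morphisms exponent Abs_hahn
  by (rule exI[of _ "\<lambda>_. 0"]) (simp add: supp_def)

lemma anti_well_ordered_exponent: "anti_well_ordered (supp (exponent x))"
  using exponent by blast

lemma exponent_Abs_hahn: "anti_well_ordered (supp f) \<Longrightarrow> exponent (Abs_hahn f) = f"
  by (simp add: Abs_hahn_inverse)

lemma hahn_eqI: "(\<And>i. exponent x i = exponent y i) \<Longrightarrow> x = y"
  using exponent_inject[of x y] by (simp add: fun_eq_iff)

instantiation hahn :: (linorder) ab_group_add
begin

definition zero_hahn :: "'a hahn" where
  "0 = Abs_hahn (\<lambda>_. 0)"

definition plus_hahn :: "'a hahn \<Rightarrow> 'a hahn \<Rightarrow> 'a hahn" where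
  "x + y = Abs_hahn (\<lambda>i. exponent x i + exponent y i)"

definition uminus_hahn :: "'a hahn \<Rightarrow> 'a hahn" where
  "- x = Abs_hahn (\<lambda>i. - exponent x i)"

definition minus_hahn :: "'a hahn \<Rightarrow> 'a hahn \<Rightarrow> 'a hahn" where
  "x - y = x + (- y :: 'a hahn)"

lemma exponent_zero [simp]: "exponent 0 i = 0"
  unfolding zero_hahn_def by (subst exponent_Abs_hahn) (simp_all add: supp_def)

lemma exponent_plus [simp]: "exponent (x + y) i = exponent x i + exponent y i"
proof -
  have "supp (\<lambda>i. exponent x i + exponent y i) \<subseteq> supp (exponent x) \<union> supp (exponent y)"
    by (auto simp: supp_def)
  then have "anti_well_ordered (supp (\<lambda>i. exponent x i + exponent y i))"
    by (meson anti_well_ordered_Un anti_well_ordered_exponent anti_well_ordered_subset)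
  then show ?thesis unfolding plus_hahn_def by (simp add: exponent_Abs_hahn)
qed

lemma exponent_uminus [simp]: "exponent (- x) i = - exponent x i"
proof -
  have "supp (\<lambda>i. - exponent x i) = supp (exponent x)"
    by (auto simp: supp_def)
  then have "anti_well_ordered (supp (\<lambda>i. - exponent x i))"
    using anti_well_ordered_exponent[of x] by simp
  then show ?thesis unfolding uminus_hahn_def by (simp add: exponent_Abs_hahn)
qed

lemma exponent_minus [simp]: "exponent (x - y) i = exponent x i - exponent y i"
  unfolding minus_hahn_def by simp

instance
  by standard (auto intro!: hahn_eqI)

end

definition hahn_positive :: "'a::linorder hahn \<Rightarrow> bool" where
  "hahn_positive x \<longleftrightarrow>
     (\<exists>i\<in>supp (exponent x). (\<forall>j\<in>supp (exponent x). j \<le> i) \<and> 0 < exponent x i)"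

lemma hahn_positive_iff:
  "hahn_positive x \<longleftrightarrow> (\<exists>i. 0 < exponent x i \<and> (\<forall>j>i. exponent x j = 0))"
proof -
  have "(\<forall>j\<in>supp (exponent x). j \<le> i) \<longleftrightarrow> (\<forall>j>i. exponent x j = 0)" for i
    by (auto simp: supp_def not_le[symmetric])
  then have "hahn_positive x \<longleftrightarrow>
      (\<exists>i. exponent x i \<noteq> 0 \<and> (\<forall>j>i. exponent x j = 0) \<and> 0 < exponent x i)"
    unfolding hahn_positive_def by (simp add: supp_def Bex_def)
  then show ?thesis by (metis less_irrefl)
qed

lemma hahn_positive_plus:
  assumes "hahn_positive x" "hahn_positive y"
  shows "hahn_positive (x + y)"
proof -
  obtain i where i: "0 < exponent x i" "\<forall>j>i. exponent x j = 0"
    using assms(1) hahn_positive_iff by blast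
  obtain k where k: "0 < exponent y k" "\<forall>j>k. exponent y j = 0"
    using assms(2) hahn_positive_iff by blast
  consider "i < k" | "i = k" | "k < i" by fastforce
  then have "0 < exponent (x + y) (max i k)"
    using i k by cases auto
  moreover have "\<forall>j>max i k. exponent (x + y) j = 0"
    using i k by auto
  ultimately show ?thesis using hahn_positive_iff by blast
qed

lemma hahn_positive_cases: "x = 0 \<or> hahn_positive x \<or> hahn_positive (- x)"
proof (cases "x = 0")
  case False
  then have "supp (exponent x) \<noteq> {}"
    using hahn_eqI[of x 0] by (auto simp: supp_def)
  then obtain i where i: "i \<in> supp (exponent x)" "\<forall>j\<in>supp (exponent x). j \<le> i"
    using anti_well_ordered_exponent[of x] unfolding anti_well_ordered_def by blast
  moreover have "supp (exponent (- x)) = supp (exponent x)"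
    by (auto simp: supp_def)
  moreover have "0 < exponent x i \<or> 0 < exponent (- x) i"
    using i by (auto simp: supp_def)
  ultimately show ?thesis unfolding hahn_positive_def by metis
qed simp

lemma hahn_not_positive_zero: "\<not> hahn_positive 0"
  unfolding hahn_positive_def by simp

instantiation hahn :: (linorder) linordered_ab_group_add
begin

definition less_hahn :: "'a hahn \<Rightarrow> 'a hahn \<Rightarrow> bool" where
  "x < y \<longleftrightarrow> hahn_positive (y - x)"

definition less_eq_hahn :: "'a hahn \<Rightarrow> 'a hahn \<Rightarrow> bool" where
  "x \<le> y \<longleftrightarrow> x < y \<or> x = (y :: 'a hahn)"

instance
proof
  fix x y z :: "'a hahn"
  have asym: "\<not> y < x" if "x < y"
    using hahn_positive_plus[of "y - x" "x - y"] that hahn_not_positive_zero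
    by (auto simp: less_hahn_def)
  then show "(x < y) = (x \<le> y \<and> \<not> y \<le> x)"
    by (auto simp: less_eq_hahn_def less_hahn_def hahn_not_positive_zero)
  show "x \<le> x" by (simp add: less_eq_hahn_def)
  show "x \<le> z" if "x \<le> y" "y \<le> z"
    using that hahn_positive_plus[of "y - x" "z - y"]
    by (auto simp: less_eq_hahn_def less_hahn_def)
  show "x = y" if "x \<le> y" "y \<le> x"
    using that asym by (auto simp: less_eq_hahn_def)
  show "x \<le> y \<or> y \<le> x"
    using hahn_positive_cases[of "y - x"] by (auto simp: less_eq_hahn_def less_hahn_def)
  show "z + x \<le> z + y" if "x \<le> y"
    using that by (auto simp: less_eq_hahn_def less_hahn_def)
qed

end

definition fundamental :: "'a::linorder \<Rightarrow> 'a hahn" where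
  "fundamental \<phi> = Abs_hahn (\<lambda>i. if i = \<phi> then 1 else 0)"

lemma exponent_fundamental [simp]: "exponent (fundamental \<phi>) i = (if i = \<phi> then 1 else 0)"
  unfolding fundamental_def by (subst exponent_Abs_hahn) (simp_all add: supp_def)

lemma fundamental_less_iff: "fundamental \<phi> < fundamental \<psi> \<longleftrightarrow> \<phi> < \<psi>"
proof -
  have *: "fundamental a < fundamental b" if "a < b" for a b :: 'a
    using that unfolding less_hahn_def hahn_positive_iff by (intro exI[of _ b]) auto
  show ?thesis using *[of \<phi> \<psi>] *[of \<psi> \<phi>] by (cases \<phi> \<psi> rule: linorder_cases) auto
qed

text \<open>A subgroup for the additively written group operation.\<close>

definition subgroup :: "'g::ab_group_add set \<Rightarrow> bool" where
  "subgroup \<Gamma> \<longleftrightarrow> 0 \<in> \<Gamma> \<and> (\<forall>x\<in>\<Gamma>. \<forall>y\<in>\<Gamma>. x + y \<in> \<Gamma>) \<and> (\<forall>x\<in>\<Gamma>. - x \<in> \<Gamma>)"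

text \<open>Generalised series with real coefficients and monomials in \<open>\<Gamma>\<close>. A coefficient function on
  \<open>\<Gamma>\<close> is represented by its extension by zero to the ambient ordered group.\<close>

definition gen_series :: "'g::linordered_ab_group_add set \<Rightarrow> ('g \<Rightarrow> real) set" where
  "gen_series \<Gamma> = {a. supp a \<subseteq> \<Gamma> \<and> anti_well_ordered (supp a)}"

text \<open>The convolution product; the index set is finite when both supports are anti-well-ordered.\<close>

definition series_mult ::
  "('g::linordered_ab_group_add \<Rightarrow> real) \<Rightarrow> ('g \<Rightarrow> real) \<Rightarrow> 'g \<Rightarrow> real" where
  "series_mult a b \<gamma> =
     (\<Sum>(\<alpha>, \<beta>) \<in> {(\<alpha>, \<beta>). \<alpha> \<in> supp a \<and> \<beta> \<in> supp b \<and> \<alpha> + \<beta> = \<gamma>}. a \<alpha> * b \<beta>)"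

definition monomial_series :: "'g \<Rightarrow> 'g \<Rightarrow> real" where
  "monomial_series \<alpha> \<beta> = (if \<beta> = \<alpha> then 1 else 0)"

text \<open>The series \<open>\<phi>'/\<phi>\<close>, that is \<open>\<phi>'\<close> multiplied by the monomial inverse to \<open>\<phi>\<close>.\<close>

definition log_deriv :: "('a::linorder \<Rightarrow> 'a hahn \<Rightarrow> real) \<Rightarrow> 'a \<Rightarrow> 'a hahn \<Rightarrow> real" where
  "log_deriv d \<phi> = series_mult (d \<phi>) (monomial_series (- fundamental \<phi>))"

lemma log_deriv_coeff: "log_deriv d \<phi> \<gamma> = d \<phi> (\<gamma> + fundamental \<phi>)"
proof -
  let ?b = "monomial_series (- fundamental \<phi>)"
  have "{(\<alpha>, \<beta>). \<alpha> \<in> supp (d \<phi>) \<and> \<beta> \<in> supp ?b \<and> \<alpha> + \<beta> = \<gamma>} =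
      (if d \<phi> (\<gamma> + fundamental \<phi>) = 0 then {} else {(\<gamma> + fundamental \<phi>, - fundamental \<phi>)})"
    by (auto simp: supp_def monomial_series_def split: if_splits)
  then show ?thesis
    unfolding log_deriv_def series_mult_def by (simp add: monomial_series_def)
qed

definition summable_family :: "'i set \<Rightarrow> ('i \<Rightarrow> 'g::linordered_ab_group_add \<Rightarrow> real) \<Rightarrow> bool" where
  "summable_family I a \<longleftrightarrow>
     anti_well_ordered (\<Union>i\<in>I. supp (a i)) \<and> (\<forall>\<alpha>. finite {i\<in>I. \<alpha> \<in> supp (a i)})"

definition extends_to_series_derivation ::
  "'a::linorder hahn set \<Rightarrow> ('a \<Rightarrow> 'a hahn \<Rightarrow> real) \<Rightarrow> bool" where
  "extends_to_series_derivation \<Gamma> d \<longleftrightarrow>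
     (\<forall>\<alpha>\<in>\<Gamma>. summable_family (supp (exponent \<alpha>)) (log_deriv d))"

text \<open>The decreasing order on \<open>A\<close>. For anti-well-ordered \<open>A\<close> it is a well-order whose isomorphism
  type is the order type of \<open>A\<close>, and order types are compared by \<^const>\<open>ordLeq\<close>.\<close>

definition decreasing_order :: "'g::linorder set \<Rightarrow> 'g rel" where
  "decreasing_order A = {(x, y). x \<in> A \<and> y \<in> A \<and> y \<le> x}"

definition final_segment :: "'g::linorder set \<Rightarrow> 'g set \<Rightarrow> bool" where
  "final_segment F B \<longleftrightarrow> F \<subseteq> B \<and> (\<forall>x\<in>F. \<forall>y\<in>B. x \<le> y \<longrightarrow> y \<in> F)"

text \<open>The isomorphism of \<open>A\<close> onto a final segment of \<open>B\<close>; if it exists, its values on \<open>A\<close> are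
  uniquely determined for anti-well-ordered \<open>A\<close> and \<open>B\<close>.\<close>

definition segment_iso :: "'g::linorder set \<Rightarrow> 'g set \<Rightarrow> 'g \<Rightarrow> 'g" where
  "segment_iso A B = (SOME f. strict_mono_on A f \<and> final_segment (f ` A) B)"

text \<open>The isomorphism \<open>I\<close> attached to two anti-well-ordered sets, as a partial map whose
  \<^const>\<open>dom\<close> is the domain of definition.\<close>

definition shift_map :: "'g::linorder set \<Rightarrow> 'g set \<Rightarrow> 'g \<rightharpoonup> 'g" where
  "shift_map A B =
     (if (decreasing_order A, decreasing_order B) \<in> ordLeq
      then (Some \<circ> segment_iso A B) |` A
      else (Some \<circ> inv_into B (segment_iso B A)) |` (segment_iso B A ` B))"

definition shift_iso :: "('a::linorder \<Rightarrow> 'a hahn \<Rightarrow> real) \<Rightarrow> 'a \<Rightarrow> 'a \<Rightarrow> 'a hahn \<rightharpoonup> 'a hahn" where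
  "shift_iso d \<mu> \<nu> = shift_map (supp (log_deriv d \<mu>)) (supp (log_deriv d \<nu>))"

definition left_shift :: "('g::linorder \<rightharpoonup> 'g) \<Rightarrow> bool" where
  "left_shift I \<longleftrightarrow> (\<forall>\<gamma>\<in>dom I. the (I \<gamma>) < \<gamma>)"

end

theory Submission
  imports Defs
begin

text \<open>For a monomial \<open>\<alpha>\<close>, the part of \<open>supp \<alpha>\<close> inside the exceptional set \<open>E\<^sub>1\<close> is both well-ordered and
  anti-well-ordered, hence finite, and a finite family is summable. So only the indices outside
  \<open>E\<^sub>1\<close> matter, and for those every \<open>I\<close> from a larger fundamental monomial is a left shift.

  Let \<open>a\<close> lie in the support of \<open>\<psi>'/\<psi>\<close> and \<open>b\<close> in that of \<open>\<phi>'/\<phi>\<close>, with \<open>\<phi> < \<psi>\<close>, \<open>\<phi>\<close> outside \<open>E\<^sub>1\<close> and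
  \<open>a \<le> b\<close>. Then \<open>b\<close> comes strictly earlier in the decreasing enumeration of its support than \<open>a\<close>
  in the enumeration of its own: otherwise the second support has an element at the position of
  \<open>a\<close>, it is at least \<open>b\<close>, and the left shift makes it smaller than \<open>a\<close>. This is lemma
  \<open>left_shift_position_less\<close>.

  A failure of summability along an anti-well-ordered index set would produce indices
  \<open>\<phi>\<^sub>0 \<ge> \<phi>\<^sub>1 \<ge> \<dots>\<close> and elements \<open>a\<^sub>0 \<le> a\<^sub>1 \<le> \<dots>\<close> of their supports, with one of the two inequalities
  strict at each step. The positions of the \<open>a\<^sub>n\<close> would then be a strictly decreasing sequence of
  ordinals. Lemma \<open>summable_family_if_position_decreasing\<close> carries this out with elements of
  minimal position in place of infinite sequences. Positions are well-orders, compared by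
  \<^const>\<open>ordLess\<close>, whose well-foundedness replaces that of the ordinals.\<close>

section \<open>Anti-well-ordered sets\<close>

lemma anti_well_ordered_ex_greatest:
  assumes "anti_well_ordered A" "X \<subseteq> A" "X \<noteq> {}"
  shows "\<exists>m\<in>X. \<forall>x\<in>X. x \<le> m"
  using assms unfolding anti_well_ordered_def by simp

lemma well_ordered_ex_least:
  assumes "well_ordered_set A" "X \<subseteq> A" "X \<noteq> {}"
  shows "\<exists>m\<in>X. \<forall>x\<in>X. m \<le> x"
  using assms unfolding well_ordered_set_def by simp

text \<open>The least element with infinitely many elements of \<open>A\<close> below it would have an immediate
  predecessor in \<open>A\<close>, with the same property.\<close>

lemma finite_if_well_ordered_anti_well_ordered:
  assumes wo: "well_ordered_set A" and awo: "anti_well_ordered A"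
  shows "finite A"
proof -
  have fin: "finite (A \<inter> {..x})" if "x \<in> A" for x
  proof (rule ccontr)
    assume "infinite (A \<inter> {..x})"
    then have "\<exists>m\<in>{y\<in>A. infinite (A \<inter> {..y})}. \<forall>x\<in>{y\<in>A. infinite (A \<inter> {..y})}. m \<le> x"
      using that by (intro well_ordered_ex_least[OF wo]) auto
    then obtain m where m: "m \<in> A" "infinite (A \<inter> {..m})"
      and least: "\<And>y. y \<in> A \<Longrightarrow> infinite (A \<inter> {..y}) \<Longrightarrow> m \<le> y"
      by blast
    have split: "A \<inter> {..m} = insert m (A \<inter> {..<m})"
      using m(1) by auto
    then have "A \<inter> {..<m} \<noteq> {}"
      using m(2) by (metis finite.emptyI finite_insert)
    then obtain z where z: "z \<in> A \<inter> {..<m}" and "\<forall>y\<in>A \<inter> {..<m}. y \<le> z"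
      using anti_well_ordered_ex_greatest[OF awo, of "A \<inter> {..<m}"] by blast
    then have "A \<inter> {..<m} \<subseteq> A \<inter> {..z}"
      by blast
    moreover have "finite (A \<inter> {..z})"
      using least[of z] z by (meson Int_iff lessThan_iff not_less)
    ultimately show False
      using m(2) split by (metis finite_insert finite_subset)
  qed
  show ?thesis
  proof (cases "A = {}")
    case False
    then obtain m where "m \<in> A" "\<And>x. x \<in> A \<Longrightarrow> x \<le> m"
      using anti_well_ordered_ex_greatest[OF awo subset_refl] by blast
    then have "A \<inter> {..m} = A"
      by auto
    then show ?thesis
      using fin[OF \<open>m \<in> A\<close>] by simp
  qed simp
qed

lemma anti_well_ordered_UN_finite:
  assumes "finite I" "\<And>i. i \<in> I \<Longrightarrow> anti_well_ordered (A i)"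
  shows "anti_well_ordered (\<Union>i\<in>I. A i)"
  using assms by (induction I) (auto intro: anti_well_ordered_Un)

text \<open>The dual of \<open>x \<le> f x\<close> for strictly increasing self-maps of a well-ordered set. If \<open>m\<close> were the
  greatest element with \<open>m < f m\<close>, then \<open>f m\<close> would be a greater one. All comparisons of
  enumerations below rest on this fact.\<close>

lemma strict_mono_on_anti_well_ordered_le:
  assumes awo: "anti_well_ordered A" and f: "strict_mono_on A f" "f ` A \<subseteq> A" and a: "a \<in> A"
  shows "f a \<le> a"
proof (rule ccontr)
  assume "\<not> f a \<le> a"
  then obtain m where m: "m \<in> A" "m < f m" and greatest: "\<And>x. x \<in> A \<Longrightarrow> x < f x \<Longrightarrow> x \<le> m"
    using anti_well_ordered_ex_greatest[OF awo, of "{x\<in>A. x < f x}"] a by (auto simp: not_le)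
  have "f m \<in> A"
    using f m by blast
  moreover from this have "f m < f (f m)"
    using strict_mono_onD[OF f(1) m(1)] m(2) by simp
  ultimately show False
    using greatest[of "f m"] m(2) by simp
qed

section \<open>Decreasing enumerations as well-orders\<close>

lemma Field_decreasing_order: "Field (decreasing_order A) = A"
  by (auto simp: decreasing_order_def Field_def)

lemma Well_order_decreasing_order:
  assumes "anti_well_ordered A"
  shows "Well_order (decreasing_order A)"
proof -
  have "Linear_order (decreasing_order A)"
    unfolding linear_order_on_def partial_order_on_def preorder_on_def Field_decreasing_order
    by (auto simp: decreasing_order_def refl_on_def trans_def antisym_def total_on_def)
  moreover have "wf (decreasing_order A - Id)"
  proof (rule wfI_min)
    fix x and Q :: "'a set"
    assume x: "x \<in> Q"
    show "\<exists>z\<in>Q. \<forall>y. (y, z) \<in> decreasing_order A - Id \<longrightarrow> y \<notin> Q"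
    proof (cases "Q \<inter> A = {}")
      case True
      then show ?thesis
        using x by (auto simp: decreasing_order_def)
    next
      case False
      then obtain m where "m \<in> Q \<inter> A" "\<And>y. y \<in> Q \<inter> A \<Longrightarrow> y \<le> m"
        using anti_well_ordered_ex_greatest[OF assms, of "Q \<inter> A"] by blast
      then show ?thesis
        by (intro bexI[of _ m]) (auto simp: decreasing_order_def dest: antisym)
    qed
  qed
  ultimately show ?thesis
    by (simp add: well_order_on_def)
qed

lemma ordLeq_decreasing_orderE:
  assumes "(decreasing_order A, decreasing_order B) \<in> ordLeq"
  obtains f where "strict_mono_on A f" "final_segment (f ` A) B"
proof -
  let ?r = "decreasing_order A" and ?s = "decreasing_order B"
  obtain f where wo: "Well_order ?r" "Well_order ?s" and f: "embed ?r ?s f"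
    using assms unfolding ordLeq_def by blast
  have inj: "inj_on f A"
    using embed_inj_on[OF wo(1) f] by (simp add: Field_decreasing_order)
  have "strict_mono_on A f"
  proof (rule strict_mono_onI)
    fix x y assume xy: "x \<in> A" "y \<in> A" "x < y"
    then have "(y, x) \<in> ?r"
      by (simp add: decreasing_order_def)
    then have "(f y, f x) \<in> ?s"
      using embed_compat[OF f] by (simp add: compat_def)
    then have "f x \<le> f y"
      by (simp add: decreasing_order_def)
    then show "f x < f y"
      using inj xy by (metis inj_onD order_le_less less_irrefl)
  qed
  moreover have "wo_rel.ofilter ?s (f ` A)"
    using embed_Field_ofilter[OF wo f] by (simp add: Field_decreasing_order)
  then have "final_segment (f ` A) B"
    unfolding wo_rel.ofilter_def[OF wo_rel.intro[OF wo(2)]] Field_decreasing_order final_segment_def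
    by (fastforce simp: under_def decreasing_order_def)
  ultimately show ?thesis
    using that by blast
qed

text \<open>Order types are totally ordered by \<^const>\<open>ordLeq\<close>, and each instance of it yields a strictly
  increasing map. Hence a strict inequality follows once the maps in the other direction are refuted.\<close>

lemma ordLess_decreasing_order_if_no_strict_mono:
  assumes "anti_well_ordered A" "anti_well_ordered B"
    and "\<And>f. strict_mono_on A f \<Longrightarrow> f ` A \<subseteq> B \<Longrightarrow> False"
  shows "(decreasing_order B, decreasing_order A) \<in> ordLess"
proof -
  have "(decreasing_order A, decreasing_order B) \<notin> ordLeq"
    using assms(3) by (metis ordLeq_decreasing_orderE final_segment_def)
  then show ?thesis
    using assms(1,2) by (simp add: not_ordLeq_iff_ordLess Well_order_decreasing_order)
qed

lemma segment_iso:
  assumes "(decreasing_order A, decreasing_order B) \<in> ordLeq"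
  shows "strict_mono_on A (segment_iso A B)" "final_segment (segment_iso A B ` A) B"
proof -
  have "\<exists>f. strict_mono_on A f \<and> final_segment (f ` A) B"
    by (meson ordLeq_decreasing_orderE[OF assms])
  then have "strict_mono_on A (segment_iso A B) \<and> final_segment (segment_iso A B ` A) B"
    unfolding segment_iso_def by (rule someI_ex)
  then show "strict_mono_on A (segment_iso A B)" "final_segment (segment_iso A B ` A) B"
    by auto
qed

text \<open>Both branches of the definition of \<^const>\<open>shift_map\<close> give an isomorphism between final segments
  of \<open>A\<close> and \<open>B\<close>, one of which is the whole set. Later arguments use only this symmetric form.\<close>

lemma shift_mapE:
  assumes "anti_well_ordered A" "anti_well_ordered B"
  obtains D J where "shift_map A B = (Some \<circ> J) |` D"
    and "strict_mono_on D J" "final_segment D A" "final_segment (J ` D) B" "D = A \<or> J ` D = B"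
proof (cases "(decreasing_order A, decreasing_order B) \<in> ordLeq")
  case True
  show ?thesis
  proof
    show "shift_map A B = (Some \<circ> segment_iso A B) |` A"
      using True by (simp add: shift_map_def)
  qed (use segment_iso[OF True] in \<open>auto simp: final_segment_def\<close>)
next
  case False
  then have "(decreasing_order B, decreasing_order A) \<in> ordLeq"
    using assms by (simp add: not_ordLeq_iff_ordLess Well_order_decreasing_order ordLess_imp_ordLeq)
  note s = segment_iso[OF this]
  let ?s = "segment_iso B A"
  have inj: "inj_on ?s B"
    using s(1) by (rule strict_mono_on_imp_inj_on)
  have img: "inv_into B ?s ` (?s ` B) = B"
    using inj by simp
  show ?thesis
  proof
    show "shift_map A B = (Some \<circ> inv_into B ?s) |` (?s ` B)"
      using False by (simp add: shift_map_def)
    show "strict_mono_on (?s ` B) (inv_into B ?s)"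
    proof (rule strict_mono_onI)
      fix x y assume "x \<in> ?s ` B" "y \<in> ?s ` B" "x < y"
      then show "inv_into B ?s x < inv_into B ?s y"
        using inj s(1) by (auto simp: strict_mono_on_less)
    qed
  qed (use s img in \<open>simp_all add: final_segment_def\<close>)
qed

section \<open>Positions and left shifts\<close>

text \<open>The elements of \<open>A\<close> enumerated no later than \<open>a\<close> are those in \<open>A \<inter> {a..}\<close>. For anti-well-ordered
  \<open>A\<close> and \<open>a \<in> A\<close> the order type of this set is the successor of the ordinal at which \<open>a\<close> appears
  in the decreasing enumeration.\<close>

definition position :: "'g::linorder set \<Rightarrow> 'g \<Rightarrow> 'g rel" where
  "position A a = decreasing_order (A \<inter> {a..})"

lemma position_less:
  assumes awo: "anti_well_ordered A" and "a \<in> A" "a < b"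
  shows "(position A b, position A a) \<in> ordLess"
  unfolding position_def
proof (rule ordLess_decreasing_order_if_no_strict_mono)
  show awo': "anti_well_ordered (A \<inter> {a..})" "anti_well_ordered (A \<inter> {b..})"
    by (rule anti_well_ordered_subset[OF awo], simp)+
  fix f assume f: "strict_mono_on (A \<inter> {a..}) f" "f ` (A \<inter> {a..}) \<subseteq> A \<inter> {b..}"
  then have "f ` (A \<inter> {a..}) \<subseteq> A \<inter> {a..}"
    using \<open>a < b\<close> by fastforce
  then have "f a \<le> a"
    using strict_mono_on_anti_well_ordered_le[OF awo'(1) f(1)] \<open>a \<in> A\<close> by simp
  moreover have "b \<le> f a"
    using f(2) \<open>a \<in> A\<close> by auto
  ultimately show False
    using \<open>a < b\<close> by simp
qed

text \<open>If the position of \<open>a\<close> in \<open>A\<close> were at most that of \<open>b\<close> in \<open>B\<close>, there would be a strictly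
  increasing \<open>f\<close> from \<open>A \<inter> {a..}\<close> into \<open>B \<inter> {b..}\<close>. Going back along the shift \<open>J\<close> gives a strictly
  increasing map \<open>g\<close> from \<open>A \<inter> {a..}\<close> to \<open>A\<close> with \<open>J (g a) = f a \<ge> b \<ge> a\<close>. As \<open>J\<close> lowers every
  element, \<open>a < g a\<close>, so \<open>g\<close> is a strictly increasing self-map of \<open>A \<inter> {a..}\<close> that raises \<open>a\<close>.\<close>

lemma left_shift_position_less:
  assumes awoA: "anti_well_ordered A" and awoB: "anti_well_ordered B"
    and shift: "left_shift (shift_map A B)"
    and a: "a \<in> A" and ab: "a \<le> b"
  shows "(position B b, position A a) \<in> ordLess"
  unfolding position_def
proof (rule ordLess_decreasing_order_if_no_strict_mono)
  show awo: "anti_well_ordered (A \<inter> {a..})" "anti_well_ordered (B \<inter> {b..})"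
    by (rule anti_well_ordered_subset[OF awoA] anti_well_ordered_subset[OF awoB], simp)+
  fix f assume f: "strict_mono_on (A \<inter> {a..}) f" "f ` (A \<inter> {a..}) \<subseteq> B \<inter> {b..}"
  obtain D J where J: "shift_map A B = (Some \<circ> J) |` D" "strict_mono_on D J"
    "final_segment D A" "final_segment (J ` D) B" "D = A \<or> J ` D = B"
    by (rule shift_mapE[OF awoA awoB])
  have less: "J x < x" if "x \<in> D" for x
    using shift that unfolding left_shift_def J(1) by auto
  have fB: "f x \<in> B" "b \<le> f x" if "x \<in> A" "a \<le> x" for x
    using f(2) that by auto
  have inj: "inj_on J D"
    using J(2) by (rule strict_mono_on_imp_inj_on)
  \<comment> \<open>If \<open>J\<close> misses part of \<open>B\<close>, then it is defined at \<open>a\<close>, and \<open>J a < a \<le> b \<le> f x\<close> puts \<open>f x\<close> into its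
    range, which is a final segment.\<close>
  have img: "f x \<in> J ` D" if "x \<in> A" "a \<le> x" for x
  proof (cases "J ` D = B")
    case False
    then have "a \<in> D"
      using J(5) a by simp
    then have "J a \<le> f x"
      using less[of a] ab fB(2)[OF that] by simp
    then show ?thesis
      using J(4) \<open>a \<in> D\<close> fB(1)[OF that] unfolding final_segment_def by blast
  qed (use fB that in simp)
  define g where "g = inv_into D J \<circ> f"
  have g: "g x \<in> D" "J (g x) = f x" if "x \<in> A" "a \<le> x" for x
    using img[OF that] by (auto simp: g_def inv_into_into f_inv_into_f)
  have gA: "g x \<in> A" if "x \<in> A" "a \<le> x" for x
    using g(1)[OF that] J(3) by (auto simp: final_segment_def)
  have mono: "strict_mono_on (A \<inter> {a..}) g"
  proof (rule strict_mono_onI)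
    fix x y assume xy: "x \<in> A \<inter> {a..}" "y \<in> A \<inter> {a..}" "x < y"
    then have "J (g x) < J (g y)"
      using g(2) f(1) by (auto simp: strict_mono_on_def)
    then show "g x < g y"
      using strict_mono_on_less[OF J(2)] g(1) xy by simp
  qed
  have "a < g a"
  proof (rule ccontr)
    assume "\<not> a < g a"
    \<comment> \<open>The final segment \<open>D\<close> contains \<open>g a\<close>, hence everything in \<open>A\<close> above it.\<close>
    then have "a \<in> D"
      using J(3) a g(1)[of a] by (auto simp: final_segment_def)
    have "J (g a) \<le> J a"
      using strict_mono_on_less_eq[OF J(2)] \<open>\<not> a < g a\<close> \<open>a \<in> D\<close> a g(1)[of a] by simp
    then show False
      using less[OF \<open>a \<in> D\<close>] g(2)[of a] fB(2)[of a] a ab by simp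
  qed
  moreover have "g a \<le> g x" if "x \<in> A" "a \<le> x" for x
    using strict_mono_on_less_eq[OF mono] a that by simp
  ultimately have "g ` (A \<inter> {a..}) \<subseteq> A \<inter> {a..}"
    using gA by fastforce
  then have "g a \<le> a"
    using strict_mono_on_anti_well_ordered_le[OF awo(1) mono] a by simp
  then show False
    using \<open>a < g a\<close> by simp
qed

section \<open>Summability\<close>

lemma summable_family_finite:
  assumes "finite I" "\<And>i. i \<in> I \<Longrightarrow> anti_well_ordered (supp (f i))"
  shows "summable_family I f"
  using assms by (simp add: summable_family_def anti_well_ordered_UN_finite)

lemma summable_family_Un:
  assumes "summable_family I f" "summable_family J f"
  shows "summable_family (I \<union> J) f"
proof -
  have "{i \<in> I \<union> J. \<alpha> \<in> supp (f i)} = {i \<in> I. \<alpha> \<in> supp (f i)} \<union> {i \<in> J. \<alpha> \<in> supp (f i)}" for \<alpha>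
    by auto
  then show ?thesis
    using assms by (simp add: summable_family_def UN_Un anti_well_ordered_Un)
qed

text \<open>Together with \<open>position_less\<close>, the hypothesis on positions says that the position strictly
  drops whenever the index weakly decreases and the element strictly increases. If a subset \<open>X\<close> of
  the union of the supports had no greatest element, then from any pair of an index \<open>i\<close> and an
  element \<open>a \<in> X\<close> of its support one would move to a larger element of \<open>X\<close>, but possibly to a
  larger index. The latter is excluded by admitting only pairs in which \<open>i\<close> is the greatest index
  whose support contains an element of \<open>X\<close> that is at least \<open>a\<close>. Then an admitted pair of minimal
  position is contradictory.

  For the finiteness condition the element stays fixed and positions drop with the index, so the
  indices concerned are well-ordered as well as anti-well-ordered.\<close>

lemma summable_family_if_position_decreasing:
  fixes f :: "'i::linorder \<Rightarrow> 'g::linordered_ab_group_add \<Rightarrow> real"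
  assumes I: "anti_well_ordered I"
    and awo: "\<And>i. i \<in> I \<Longrightarrow> anti_well_ordered (supp (f i))"
    and dec: "\<And>i j a b. i \<in> I \<Longrightarrow> j \<in> I \<Longrightarrow> j < i \<Longrightarrow> a \<in> supp (f i) \<Longrightarrow> b \<in> supp (f j) \<Longrightarrow>
      a \<le> b \<Longrightarrow> (position (supp (f j)) b, position (supp (f i)) a) \<in> ordLess"
  shows "summable_family I f"
  unfolding summable_family_def
proof (intro conjI allI)
  let ?pos = "\<lambda>(i, a). position (supp (f i)) a"
  have wf: "wf (inv_image ordLess ?pos)"
    by (rule wf_inv_image[OF wf_ordLess])
  show "anti_well_ordered (\<Union>i\<in>I. supp (f i))"
    unfolding anti_well_ordered_def
  proof (intro allI impI)
    fix X assume X: "X \<subseteq> (\<Union>i\<in>I. supp (f i))" "X \<noteq> {}"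
    define above where "above x = {i\<in>I. \<exists>b\<in>X. x \<le> b \<and> b \<in> supp (f i)}" for x
    define P where "P = {(i, a). i \<in> I \<and> a \<in> X \<and> a \<in> supp (f i) \<and> (\<forall>j\<in>above a. j \<le> i)}"
    have ex: "\<exists>i b. (i, b) \<in> P \<and> x \<le> b \<and> i \<in> above x" if xX: "x \<in> X" for x
    proof -
      obtain k where "k \<in> I" "x \<in> supp (f k)"
        using X(1) xX by blast
      then have "above x \<subseteq> I" "above x \<noteq> {}"
        using xX by (auto simp: above_def)
      then obtain i where i: "i \<in> above x" "\<forall>j\<in>above x. j \<le> i"
        using anti_well_ordered_ex_greatest[OF I] by blast
      then obtain b where b: "b \<in> X" "x \<le> b" "b \<in> supp (f i)" "i \<in> I"
        by (auto simp: above_def)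
      have "above b \<subseteq> above x"
        using b(2) unfolding above_def by (auto intro: order_trans)
      then have "(i, b) \<in> P"
        using i b by (auto simp: P_def)
      then show ?thesis
        using i b by blast
    qed
    then have "P \<noteq> {}"
      using X(2) by blast
    then obtain p where "p \<in> P" and "\<And>q. (q, p) \<in> inv_image ordLess ?pos \<Longrightarrow> q \<notin> P"
      using wfE_min'[OF wf] by metis
    moreover obtain i a where "p = (i, a)"
      by fastforce
    ultimately have ia: "(i, a) \<in> P"
      and min: "\<And>j b. (position (supp (f j)) b, position (supp (f i)) a) \<in> ordLess \<Longrightarrow> (j, b) \<notin> P"
      by auto
    have "x \<le> a" if xX: "x \<in> X" for x
    proof (rule ccontr)
      assume "\<not> x \<le> a"
      then have "a < x"
        by simp
      obtain j b where jb: "(j, b) \<in> P" "x \<le> b" "j \<in> above x"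
        using ex[OF xX] by blast
      have "a < b"
        using \<open>a < x\<close> jb(2) by (rule less_le_trans)
      have "j \<in> above a"
        using jb(3) \<open>a < x\<close> unfolding above_def by (blast intro: order_trans less_imp_le)
      then have "j \<le> i"
        using ia by (auto simp: P_def)
      then have "(position (supp (f j)) b, position (supp (f i)) a) \<in> ordLess"
      proof (cases "j = i")
        case True
        then show ?thesis
          using ia \<open>a < b\<close> by (auto simp: P_def intro: position_less awo)
      next
        case False
        then show ?thesis
          using dec[of i j a b] ia jb(1) \<open>j \<le> i\<close> \<open>a < b\<close> by (simp add: P_def)
      qed
      then show False
        using min jb(1) by blast
    qed
    then show "\<exists>m\<in>X. \<forall>x\<in>X. x \<le> m"
      using ia by (auto simp: P_def)
  qed
  fix \<alpha>
  let ?F = "{i\<in>I. \<alpha> \<in> supp (f i)}"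
  show "finite ?F"
  proof (rule finite_if_well_ordered_anti_well_ordered)
    show "anti_well_ordered ?F"
      using I by (rule anti_well_ordered_subset) auto
    show "well_ordered_set ?F"
      unfolding well_ordered_set_def
    proof (intro allI impI)
      fix X assume X: "X \<subseteq> ?F" "X \<noteq> {}"
      then obtain i where i: "i \<in> X"
        and min: "\<And>j. (position (supp (f j)) \<alpha>, position (supp (f i)) \<alpha>) \<in> ordLess \<Longrightarrow> j \<notin> X"
        by (elim wfE_min'[OF wf_inv_image[OF wf_ordLess, of "\<lambda>i. position (supp (f i)) \<alpha>"], of X])
          simp
      have "i \<le> j" if "j \<in> X" for j
        using min[of j] dec[of i j \<alpha> \<alpha>] i that X(1)
        by (metis (no_types, lifting) mem_Collect_eq not_le order_refl subsetD)
      then show "\<exists>m\<in>X. \<forall>x\<in>X. m \<le> x"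
        using i by blast
    qed
  qed
qed

lemma anti_well_ordered_supp_log_deriv:
  assumes "anti_well_ordered (supp (d \<phi>))"
  shows "anti_well_ordered (supp (log_deriv d \<phi>))"
  unfolding anti_well_ordered_def
proof (intro allI impI)
  fix X assume X: "X \<subseteq> supp (log_deriv d \<phi>)" "X \<noteq> {}"
  let ?Y = "(\<lambda>\<gamma>. \<gamma> + fundamental \<phi>) ` X"
  have "?Y \<subseteq> supp (d \<phi>)"
    using X(1) by (auto simp: supp_def log_deriv_coeff)
  then obtain m where "m \<in> ?Y" "\<forall>y\<in>?Y. y \<le> m"
    using anti_well_ordered_ex_greatest[OF assms, of ?Y] X(2) by blast
  then show "\<exists>m\<in>X. \<forall>x\<in>X. x \<le> m"
    by fastforce
qed

theorem corollary3p12: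
  fixes \<Gamma> :: "'a::linorder hahn set"
    and d :: "'a \<Rightarrow> 'a hahn \<Rightarrow> real"
  assumes "subgroup \<Gamma>"
    and "range fundamental \<subseteq> \<Gamma>"
    and "\<And>\<phi>. d \<phi> \<in> gen_series \<Gamma> - {\<lambda>_. 0}"
    and "well_ordered_set {\<phi>. \<exists>\<psi>. \<psi> > \<phi> \<and> \<not> left_shift (shift_iso d \<psi> \<phi>)}"
  shows "extends_to_series_derivation \<Gamma> d"
  unfolding extends_to_series_derivation_def
proof
  fix \<alpha> :: "'a hahn"
  let ?S = "supp (exponent \<alpha>)"
  let ?E = "{\<phi>. \<exists>\<psi>. \<psi> > \<phi> \<and> \<not> left_shift (shift_iso d \<psi> \<phi>)}"
  have S: "anti_well_ordered ?S"
    by (rule anti_well_ordered_exponent)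
  have awo: "anti_well_ordered (supp (log_deriv d \<phi>))" for \<phi>
    using assms(3)[of \<phi>] by (intro anti_well_ordered_supp_log_deriv) (simp add: gen_series_def)
  have "well_ordered_set (?S \<inter> ?E)"
    using assms(4) unfolding well_ordered_set_def by (meson inf.boundedE)
  then have "finite (?S \<inter> ?E)"
    using anti_well_ordered_subset[OF S, of "?S \<inter> ?E"]
    by (intro finite_if_well_ordered_anti_well_ordered) auto
  then have "summable_family (?S \<inter> ?E) (log_deriv d)"
    using awo by (intro summable_family_finite)
  moreover have "summable_family (?S - ?E) (log_deriv d)"
  proof (rule summable_family_if_position_decreasing)
    show "anti_well_ordered (?S - ?E)"
      using S by (rule anti_well_ordered_subset) auto
    fix \<psi> \<phi> a b
    assume "\<phi> \<in> ?S - ?E" "\<phi> < \<psi>" "a \<in> supp (log_deriv d \<psi>)" "a \<le> b"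
    then show "(position (supp (log_deriv d \<phi>)) b, position (supp (log_deriv d \<psi>)) a) \<in> ordLess"
      using left_shift_position_less[OF awo awo] by (auto simp: shift_iso_def)
  qed (rule awo)
  ultimately have "summable_family ((?S \<inter> ?E) \<union> (?S - ?E)) (log_deriv d)"
    by (rule summable_family_Un)
  then show "summable_family ?S (log_deriv d)"
    by (simp only: Int_Diff_Un)
qed

end
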